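(* Let $G$ be a $2$-connected graph which is a spanning subgraph of an $\{a,b,c,d\}$-web, and let $X=\{a,b,c,d\}\subseteq V(G)$. If $G$ does not have a $W_4(X)$-minor, then $G$ does not have a $K_{2,4}(X)$-minor.
   Context: Graphs are finite and undirected. An $H$-model in $G$ is a family $\{G_x: x\in V(H)\}$ of pairwise disjoint connected (nonempty) subgraphs of $G$ (branch sets) such that for each $xy\in E(H)$ some edge of $G$ joins $G_x$ to $G_y$. Let $X$ be a set of four vertices of $G$. $G$ has a $W_4(X)$-minor if there are a $W_4$-model in $G$ ($W_4$ is a $4$-cycle, the rim, plus a vertex adjacent to all rim vertices) and an injective map $f$ from $X$ to the rim vertices with $v\in V(G_{f(v)})$ for all $v\in X$. $G$ has a $K_{2,4}(X)$-minor if there are a $K_{2,4}$-model in $G$ and an injective map $f$ from $X$ to the four vertices of the larger side of the bipartition of $K_{2,4}$ with $v\in V(G_{f(v)})$ for all $v\in X$. Given a graph $H$, a graph $H^+=(H,F)$ is obtained by attaching to each triangle $T$ of $H$ a clique $F_T$ of arbitrary (possibly zero) size: each vertex of $F_T$ is adjacent to every vertex of $T$ and to no other vertex of $H$. An $\{a,b,c,d\}$-web is a graph $H^+$ where $H$ is a planar graph whose outer face is bounded by a $4$-cycle with vertex set $\{a,b,c,d\}$, every internal face of $H$ is a triangle, and every triangle of $H$ is a face. *)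

theory Defs
  imports "HOL-Analysis.Analysis" "Graph_Theory.Graph_Theory"
begin

text \<open>
  A finite simple undirected graph is a \<open>pair_graph\<close>: a finite, symmetric, loop-free digraph
  without parallel arcs. The names \<open>connected\<close> and \<open>components\<close> exist both for graphs and for
  topological spaces, so the graph version of \<open>connected\<close> is written with its qualifier.
\<close>

definition two_connected :: "'a pair_pre_digraph \<Rightarrow> bool" where
  "two_connected G \<longleftrightarrow>
     3 \<le> card (pverts G) \<and>
     Digraph_Component.connected (with_proj G) \<and>
     (\<forall>v\<in>pverts G. Digraph_Component.connected (pre_digraph.del_vert (with_proj G) v))"


section \<open>Rooted minors\<close>

text \<open>\<open>Digraph_Component.connected\<close> includes that the vertex set is nonempty; \<open>pair_graph (B x)\<close>
  makes the branch set an undirected subgraph, since \<open>subgraph\<close> alone allows one-way arcs.\<close>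

definition minor_model ::
  "'h pair_pre_digraph \<Rightarrow> 'a pair_pre_digraph \<Rightarrow> ('h \<Rightarrow> 'a pair_pre_digraph) \<Rightarrow> bool" where
  "minor_model K G B \<longleftrightarrow>
     (\<forall>x\<in>pverts K. pair_graph (B x) \<and> subgraph (with_proj (B x)) (with_proj G) \<and>
        Digraph_Component.connected (with_proj (B x))) \<and>
     (\<forall>x\<in>pverts K. \<forall>y\<in>pverts K. x \<noteq> y \<longrightarrow> pverts (B x) \<inter> pverts (B y) = {}) \<and>
     (\<forall>(x, y)\<in>parcs K. \<exists>u\<in>pverts (B x). \<exists>v\<in>pverts (B y). (u, v) \<in> parcs G)"

definition rooted_minor ::
  "'h pair_pre_digraph \<Rightarrow> 'h set \<Rightarrow> 'a set \<Rightarrow> 'a pair_pre_digraph \<Rightarrow> bool" where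
  "rooted_minor K R X G \<longleftrightarrow>
     (\<exists>B f. minor_model K G B \<and> inj_on f X \<and> f ` X \<subseteq> R \<and> (\<forall>v\<in>X. v \<in> pverts (B (f v))))"

definition W4_rim :: "nat set" where
  "W4_rim = {0, 1, 2, 3}"

definition W4 :: "nat pair_pre_digraph" where
  "W4 = \<lparr> pverts = insert 4 W4_rim,
          parcs = symcl ({(0, 1), (1, 2), (2, 3), (3, 0)} \<union> {4} \<times> W4_rim) \<rparr>"

definition K24_large_side :: "nat set" where
  "K24_large_side = {0, 1, 2, 3}"

definition K24 :: "nat pair_pre_digraph" where
  "K24 = \<lparr> pverts = {4, 5} \<union> K24_large_side, parcs = symcl ({4, 5} \<times> K24_large_side) \<rparr>"

definition has_W4_minor :: "'a set \<Rightarrow> 'a pair_pre_digraph \<Rightarrow> bool" where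
  "has_W4_minor X G \<longleftrightarrow> rooted_minor W4 W4_rim X G"

definition has_K24_minor :: "'a set \<Rightarrow> 'a pair_pre_digraph \<Rightarrow> bool" where
  "has_K24_minor X G \<longleftrightarrow> rooted_minor K24 K24_large_side X G"

lemma pair_graph_W4: "pair_graph W4"
  by unfold_locales (auto simp: W4_def W4_rim_def symcl_def symmetric_def intro!: symI)

lemma complete_bipartite_K24: "complete_bipartite_digraph 2 4 (with_proj K24)"
proof -
  have "symcl (A \<times> B) = A \<times> B \<union> B \<times> A" for A B :: "nat set"
    unfolding symcl_def by auto
  then have "parcs K24 = {4, 5} \<times> K24_large_side \<union> K24_large_side \<times> {4, 5}"
    by (simp add: K24_def)
  moreover have "pverts K24 = {4, 5} \<union> K24_large_side"
    by (simp add: K24_def)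
  moreover have "{4, 5} \<inter> K24_large_side = {}" "card {4, 5 :: nat} = 2" "card K24_large_side = 4"
    and "finite ({4, 5} \<union> K24_large_side)"
    by (simp_all add: K24_large_side_def)
  ultimately show ?thesis
    unfolding complete_bipartite_digraph_pair_def by metis
qed


section \<open>Plane drawings and their faces\<close>

text \<open>The two arcs of an undirected edge are drawn as the same curve, traversed in opposite
  directions.\<close>

definition plane_drawing ::
  "'a pair_pre_digraph \<Rightarrow> ('a \<Rightarrow> complex) \<Rightarrow> ('a \<times> 'a \<Rightarrow> real \<Rightarrow> complex) \<Rightarrow> bool" where
  "plane_drawing H p \<gamma> \<longleftrightarrow>
     inj_on p (pverts H) \<and>
     (\<forall>(u, v)\<in>parcs H.
        Path_Connected.arc (\<gamma> (u, v)) \<and> pathstart (\<gamma> (u, v)) = p u \<and> pathfinish (\<gamma> (u, v)) = p v \<and>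
        \<gamma> (v, u) = reversepath (\<gamma> (u, v)) \<and>
        path_image (\<gamma> (u, v)) \<inter> p ` pverts H = {p u, p v}) \<and>
     (\<forall>(u, v)\<in>parcs H. \<forall>(x, y)\<in>parcs H. {u, v} \<noteq> {x, y} \<longrightarrow>
        path_image (\<gamma> (u, v)) \<inter> path_image (\<gamma> (x, y)) \<subseteq> p ` ({u, v} \<inter> {x, y}))"

definition drawn_arcs :: "('a \<times> 'a \<Rightarrow> real \<Rightarrow> complex) \<Rightarrow> ('a \<times> 'a) set \<Rightarrow> complex set" where
  "drawn_arcs \<gamma> E = (\<Union>e\<in>E. path_image (\<gamma> e))"

definition faces ::
  "'a pair_pre_digraph \<Rightarrow> ('a \<Rightarrow> complex) \<Rightarrow> ('a \<times> 'a \<Rightarrow> real \<Rightarrow> complex) \<Rightarrow> complex set set" where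
  "faces H p \<gamma> = components (- (p ` pverts H \<union> drawn_arcs \<gamma> (parcs H)))"


section \<open>Webs\<close>

text \<open>Cycles are given by their lists of arcs, so \<open>fst ` set c\<close> is the vertex set of \<open>c\<close>.\<close>

definition cycles_of_length :: "nat \<Rightarrow> 'a pair_pre_digraph \<Rightarrow> ('a \<times> 'a) list set" where
  "cycles_of_length n H = {c. pre_digraph.cycle (with_proj H) c \<and> length c = n}"

definition triangles :: "'a pair_pre_digraph \<Rightarrow> 'a set set" where
  "triangles H = (\<lambda>c. fst ` set c) ` cycles_of_length 3 H"

definition attachable :: "'a pair_pre_digraph \<Rightarrow> ('a set \<Rightarrow> 'a set) \<Rightarrow> bool" where
  "attachable H F \<longleftrightarrow>
     (\<forall>T\<in>triangles H. finite (F T) \<and> F T \<inter> pverts H = {}) \<and>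
     (\<forall>T\<in>triangles H. \<forall>T'\<in>triangles H. T \<noteq> T' \<longrightarrow> F T \<inter> F T' = {})"

definition attach_cliques ::
  "'a pair_pre_digraph \<Rightarrow> ('a set \<Rightarrow> 'a set) \<Rightarrow> 'a pair_pre_digraph" where
  "attach_cliques H F =
     \<lparr> pverts = pverts H \<union> (\<Union>T\<in>triangles H. F T),
       parcs = parcs H \<union>
         (\<Union>T\<in>triangles H. {(x, y). x \<in> F T \<and> y \<in> F T \<and> x \<noteq> y} \<union> symcl (F T \<times> T)) \<rparr>"

definition web_skeleton :: "'a set \<Rightarrow> 'a pair_pre_digraph \<Rightarrow> bool" where
  "web_skeleton X H \<longleftrightarrow>
     pair_graph H \<and>
     (\<exists>p \<gamma>. plane_drawing H p \<gamma> \<and>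
        (\<exists>U\<in>faces H p \<gamma>.
           \<not> bounded U \<and>
           (\<exists>c\<in>cycles_of_length 4 H. fst ` set c = X \<and> frontier U = drawn_arcs \<gamma> (set c)) \<and>
           (\<forall>D\<in>faces H p \<gamma>. D \<noteq> U \<longrightarrow>
              (\<exists>c\<in>cycles_of_length 3 H. frontier D = drawn_arcs \<gamma> (set c)))) \<and>
        (\<forall>c\<in>cycles_of_length 3 H. \<exists>D\<in>faces H p \<gamma>. frontier D = drawn_arcs \<gamma> (set c)))"

definition web :: "'a set \<Rightarrow> 'a pair_pre_digraph \<Rightarrow> bool" where
  "web X W \<longleftrightarrow> (\<exists>H F. web_skeleton X H \<and> attachable H F \<and> W = attach_cliques H F)"

lemma cycle_of_length_3_iff:
  assumes "pair_graph H"
  shows "c \<in> cycles_of_length 3 H \<longleftrightarrow>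
    (\<exists>x y z. c = [(x, y), (y, z), (z, x)] \<and> distinct [x, y, z] \<and>
       (x, y) \<in> parcs H \<and> (y, z) \<in> parcs H \<and> (z, x) \<in> parcs H)"
proof -
  interpret pair_graph H by fact
  have cyc: "cycle [(x, x'), (y, y'), (z, z')] \<longleftrightarrow>
      x' = y \<and> y' = z \<and> z' = x \<and> distinct [x, y, z] \<and>
      (x, y) \<in> parcs H \<and> (y, z) \<in> parcs H \<and> (z, x) \<in> parcs H" for x x' y y' z z'
    unfolding cycle_def awalk_def by (auto dest: wellformed')
  show ?thesis
  proof
    assume "c \<in> cycles_of_length 3 H"
    then have "cycle c" and "length c = 3"
      by (simp_all add: cycles_of_length_def)
    from \<open>length c = 3\<close> obtain x x' y y' z z' where c: "c = [(x, x'), (y, y'), (z, z')]"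
      unfolding numeral_3_eq_3 length_Suc_conv by fastforce
    show "\<exists>x y z. c = [(x, y), (y, z), (z, x)] \<and> distinct [x, y, z] \<and>
       (x, y) \<in> parcs H \<and> (y, z) \<in> parcs H \<and> (z, x) \<in> parcs H"
      using \<open>cycle c\<close> cyc[of x x' y y' z z'] c by blast
  next
    assume "\<exists>x y z. c = [(x, y), (y, z), (z, x)] \<and> distinct [x, y, z] \<and>
       (x, y) \<in> parcs H \<and> (y, z) \<in> parcs H \<and> (z, x) \<in> parcs H"
    then obtain x y z where c: "c = [(x, y), (y, z), (z, x)]"
      and xyz: "distinct [x, y, z]" "(x, y) \<in> parcs H" "(y, z) \<in> parcs H" "(z, x) \<in> parcs H"
      by blast
    have "cycle c"
      unfolding c cyc using xyz by blast
    then show "c \<in> cycles_of_length 3 H"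
      by (simp add: cycles_of_length_def c)
  qed
qed

lemma triangles_iff:
  assumes "pair_graph H"
  shows "T \<in> triangles H \<longleftrightarrow>
    (\<exists>x y z. T = {x, y, z} \<and> distinct [x, y, z] \<and>
       (x, y) \<in> parcs H \<and> (y, z) \<in> parcs H \<and> (z, x) \<in> parcs H)"
  unfolding triangles_def image_iff Bex_def cycle_of_length_3_iff[OF assms]
  by fastforce

lemma pair_graph_attach_cliques:
  assumes "pair_graph H" "attachable H F"
  shows "pair_graph (attach_cliques H F)"
proof -
  interpret H: pair_graph H by fact
  have sub: "T \<subseteq> pverts H" if "T \<in> triangles H" for T
    using that unfolding triangles_iff[OF assms(1)] by (auto dest: H.wellformed')
  have "triangles H \<subseteq> Pow (pverts H)"
    using sub by blast
  then have fin: "finite (triangles H)"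
    by (rule finite_subset) (simp add: H.pair_finite_verts)
  have finV: "finite (pverts (attach_cliques H F))"
    using fin assms(2) H.pair_finite_verts by (auto simp: attach_cliques_def attachable_def)
  have wf: "e \<in> pverts (attach_cliques H F) \<times> pverts (attach_cliques H F)"
    if "e \<in> parcs (attach_cliques H F)" for e
    using that sub by (cases e) (fastforce simp: attach_cliques_def symcl_def dest: H.wellformed')
  have "parcs (attach_cliques H F) \<subseteq> pverts (attach_cliques H F) \<times> pverts (attach_cliques H F)"
    using wf by blast
  then have finE: "finite (parcs (attach_cliques H F))"
    by (rule finite_subset) (simp add: finV)
  have symE: "(y, x) \<in> parcs (attach_cliques H F)" if "(x, y) \<in> parcs (attach_cliques H F)" for x y
    using that by (auto simp: attach_cliques_def symcl_def dest: H.arcs_symmetric)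
  have noloop: "x \<noteq> y" if "(x, y) \<in> parcs (attach_cliques H F)" for x y
    using that sub assms(2)
    by (fastforce simp: attach_cliques_def attachable_def symcl_def dest: H.no_loops')
  show ?thesis
  proof unfold_locales
    show "symmetric (with_proj (attach_cliques H F))"
      by (auto simp: symmetric_def intro!: symI symE)
  qed (use wf finV finE noloop in \<open>auto simp: mem_Times_iff\<close>)
qed

end

theory Submission
  imports Defs
begin

text \<open>
  A \<open>K\<^bsub>2,4\<^esub>(X)\<close>-minor joins two opposite vertices of the outer \<open>4\<close>-cycle through one hub and the
  other two through the second hub, so it gives two disjoint connections with alternating ends on
  the outer cycle. They can be pushed out of the attached cliques into the plane graph \<open>H\<close>, where
  they become disjoint arcs inside the Jordan curve formed by the outer cycle. The first arc cuts
  the inside into two parts whose closures contain only one end of the second arc each.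
\<close>

section \<open>Crossing arcs and Jordan curves in the plane\<close>

text \<open>The curves \<open>c1\<close>, \<open>c2\<close> and \<open>g\<close> form a theta graph.
  If \<open>h\<close> missed \<open>g\<close>, then \<open>h\<close> without its ends, being
  connected, would lie in one of the two regions into which \<open>g\<close> splits the inside, and
  the end of \<open>h\<close> on the opposite boundary arc would be out of reach.\<close>

lemma crossing_arcs_in_Jordan_curve:
  fixes c1 c2 g h :: "real \<Rightarrow> complex"
  assumes "Path_Connected.arc c1" and c1: "pathstart c1 = u" "pathfinish c1 = w"
    and "Path_Connected.arc c2" and c2: "pathstart c2 = u" "pathfinish c2 = w"
    and c12: "path_image c1 \<inter> path_image c2 = {u, w}"
    and "Path_Connected.arc g" and g: "pathstart g = u" "pathfinish g = w"
    and g_inside: "path_image g - {u, w} \<subseteq> inside (path_image c1 \<union> path_image c2)"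
    and "Path_Connected.arc h" and h: "pathstart h = x" "pathfinish h = y"
    and h_inside: "path_image h - {x, y} \<subseteq> inside (path_image c1 \<union> path_image c2)"
    and x: "x \<in> path_image c1 - {u, w}" and y: "y \<in> path_image c2 - {u, w}"
  shows "path_image g \<inter> path_image h \<noteq> {}"
proof
  assume gh: "path_image g \<inter> path_image h = {}"
  let ?C = "path_image c1 \<union> path_image c2"
  have sp: "simple_path c1" "simple_path c2" "simple_path g" "simple_path h"
    using assms by (auto intro: arc_imp_simple_path)
  have "u \<noteq> w"
    using arc_distinct_ends[OF \<open>Path_Connected.arc c1\<close>] c1 by simp
  have no: "inside ?C \<inter> ?C = {}"
    by (simp add: inside_no_overlap)
  have ends: "u \<in> path_image g" "w \<in> path_image g" "u \<in> path_image c1" "w \<in> path_image c1"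
    "u \<in> path_image c2" "w \<in> path_image c2" "y \<in> path_image h" "x \<in> path_image h"
    using g c1 c2 h by (metis pathstart_in_path_image pathfinish_in_path_image)+
  have c1g: "path_image c1 \<inter> path_image g = {u, w}" and c2g: "path_image c2 \<inter> path_image g = {u, w}"
    using no g_inside ends by blast+
  have "path_image g - {u, w} \<noteq> {}"
    using nonempty_simple_path_endless[OF sp(3)] g by simp
  then have "path_image g \<inter> inside ?C \<noteq> {}"
    using g_inside by blast
  from split_inside_simple_closed_curve[OF sp(1) c1 sp(2) c2 sp(3) g \<open>u \<noteq> w\<close> c12 c1g c2g this]
  have disj: "inside (path_image c1 \<union> path_image g) \<inter> inside (path_image c2 \<union> path_image g) = {}"
    and split: "inside (path_image c1 \<union> path_image g) \<union> inside (path_image c2 \<union> path_image g) \<union>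
           (path_image g - {u, w}) = inside ?C"
    by metis+
  define D where "D = path_image h - {x, y}"
  have "Topological_Spaces.connected D"
    using connected_simple_path_endless[OF sp(4)] h by (simp add: D_def)
  have "D \<noteq> {}"
    using nonempty_simple_path_endless[OF sp(4)] h by (simp add: D_def)
  have clo: "closed (path_image c1 \<union> path_image g)" "closed (path_image c2 \<union> path_image g)"
    using sp by (auto intro!: closed_Un closed_path_image simple_path_imp_path)
  have D_sub: "D \<subseteq> inside (path_image c1 \<union> path_image g) \<union> inside (path_image c2 \<union> path_image g)"
    using h_inside split gh unfolding D_def by blast
  \<comment> \<open>Here \<open>ci\<close> bounds the region holding \<open>D\<close>, and
    \<open>z\<close> is the end of \<open>h\<close> on the other boundary arc. The closure of that
    region adds only points of \<open>ci\<close> and \<open>g\<close>, so it omits \<open>z\<close>;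
    then the closed sets \<open>{z}\<close> and \<open>closure D \<union> {z'}\<close> separate the
    connected image of \<open>h\<close>.\<close>
  have False
    if D: "D \<subseteq> inside (path_image ci \<union> path_image g)" and "closed (path_image ci \<union> path_image g)"
      and z: "z = x \<or> z = y" "z \<notin> path_image ci" and z': "z' = x \<or> z' = y" "z \<noteq> z'" "z' \<in> path_image ci"
      and ci: "inside (path_image ci \<union> path_image g) \<subseteq> inside ?C"
    for ci z z'
  proof -
    have "z \<notin> closure (inside (path_image ci \<union> path_image g))"
      using closure_inside_subset[OF \<open>closed (path_image ci \<union> path_image g)\<close>] z ci no x y gh ends by blast
    moreover have "closure D \<subseteq> closure (inside (path_image ci \<union> path_image g))"
      using D by (rule closure_mono)
    ultimately have nz: "z \<notin> closure D" by blast
    have "path_image h \<subseteq> (closure D \<union> {z'}) \<union> {z}"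
      using z z' closure_subset[of D] unfolding D_def by blast
    moreover have "Topological_Spaces.connected (path_image h)"
      using sp(4) by (simp add: connected_simple_path_image)
    moreover have "(closure D \<union> {z'}) \<inter> path_image h \<noteq> {}" "{z} \<inter> path_image h \<noteq> {}"
      using z z' ends by auto
    ultimately show False
      using connected_closedD[of "path_image h" "closure D \<union> {z'}" "{z}"] nz z'(2) by auto
  qed
  note no_side = this
  have xy: "x \<notin> path_image c2" "y \<notin> path_image c1" "x \<noteq> y"
    using x y c12 by blast+
  have "open (inside (path_image c1 \<union> path_image g))" "open (inside (path_image c2 \<union> path_image g))"
    using clo by (auto intro: open_inside)
  then have "D \<subseteq> inside (path_image c1 \<union> path_image g) \<or> D \<subseteq> inside (path_image c2 \<union> path_image g)"
    using connectedD[OF \<open>Topological_Spaces.connected D\<close>, of "inside (path_image c1 \<union> path_image g)"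
      "inside (path_image c2 \<union> path_image g)"] disj D_sub by blast
  then show False
    using no_side[of c1 y x] no_side[of c2 x y] clo xy x y split by blast
qed

text \<open>As the inside of \<open>k\<close> is bounded, \<open>U\<close> meets the outside. The
  outside is connected and misses \<open>frontier U\<close>, so it lies wholly in \<open>U\<close>,
  which misses \<open>D\<close>.\<close>

lemma unbounded_face_bounded_by_Jordan_curve:
  fixes k :: "real \<Rightarrow> complex"
  assumes "U \<in> components (- D)" "\<not> bounded U" "frontier U = path_image k" "path_image k \<subseteq> D"
    and "simple_path k" "pathfinish k = pathstart k"
  shows "D \<subseteq> path_image k \<union> inside (path_image k)"
proof -
  have J: "Topological_Spaces.connected (outside (path_image k))" "bounded (inside (path_image k))"
    "inside (path_image k) \<union> outside (path_image k) = - path_image k"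
    using Jordan_inside_outside[OF assms(5,6)] by auto
  have "U \<subseteq> - D"
    using assms(1) by (rule in_components_subset)
  then have "U \<subseteq> inside (path_image k) \<union> outside (path_image k)"
    using assms(4) J(3) by blast
  then have "outside (path_image k) \<inter> U \<noteq> {}"
    using assms(2) J(2) bounded_subset by blast
  then have "outside (path_image k) - U = {}"
    using connected_Int_frontier[OF J(1)] assms(3) outside_no_overlap by blast
  then show ?thesis
    using \<open>U \<subseteq> - D\<close> J(3) by blast
qed

section \<open>Plane drawings of graphs\<close>

context
  fixes H :: "'a pair_pre_digraph" and p \<gamma>
  assumes drawing: "plane_drawing H p \<gamma>"
begin

lemma drawn_arc:
  assumes "(u, v) \<in> parcs H"
  shows "Path_Connected.arc (\<gamma> (u, v))" "pathstart (\<gamma> (u, v)) = p u" "pathfinish (\<gamma> (u, v)) = p v"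
    "path_image (\<gamma> (v, u)) = path_image (\<gamma> (u, v))"
  using drawing assms unfolding plane_drawing_def by auto

text \<open>Concatenating curves along a walk gives a path, possibly self-intersecting, which
  contains an arc with the same ends. \<open>R\<^sup>+\<close> excludes the empty walk, whose point
  \<open>p u\<close> need not lie on the drawing of \<open>R\<close>.\<close>

lemma arc_in_drawn_arcs:
  assumes "R \<subseteq> parcs H" "(u, v) \<in> R\<^sup>+" "p u \<noteq> p v"
  obtains g where "Path_Connected.arc g" "pathstart g = p u" "pathfinish g = p v"
    "path_image g \<subseteq> drawn_arcs \<gamma> R"
proof -
  have edge: "path_component (drawn_arcs \<gamma> R) (p y) (p z)" if "(y, z) \<in> R" for y z
    unfolding path_component_def
    using that assms(1) drawn_arc[of y z] by (intro exI[of _ "\<gamma> (y, z)"])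
      (auto simp: drawn_arcs_def intro: arc_imp_path)
  from assms(2) have "path_component (drawn_arcs \<gamma> R) (p u) (p v)"
    by (induction rule: trancl_induct) (blast intro: edge path_component_trans)+
  then obtain q where "path q" "path_image q \<subseteq> drawn_arcs \<gamma> R" "pathstart q = p u" "pathfinish q = p v"
    unfolding path_component_def by blast
  then show ?thesis
    using path_contains_arc[of q "p u" "p v"] assms(3) that by (metis order_trans)
qed

text \<open>In a plane drawing two different edges meet only in common ends. Edges are compared as
  unordered pairs because both orientations carry the same curve.\<close>

lemma drawn_arcs_Int:
  assumes "R \<subseteq> parcs H" "R' \<subseteq> parcs H"
    and "\<And>u v x y. (u, v) \<in> R \<Longrightarrow> (x, y) \<in> R' \<Longrightarrow> {u, v} \<noteq> {x, y}"
  shows "drawn_arcs \<gamma> R \<inter> drawn_arcs \<gamma> R' \<subseteq> p ` (Field R \<inter> Field R')"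
proof
  fix z assume "z \<in> drawn_arcs \<gamma> R \<inter> drawn_arcs \<gamma> R'"
  then obtain u v x y where *: "(u, v) \<in> R" "(x, y) \<in> R'"
    "z \<in> path_image (\<gamma> (u, v)) \<inter> path_image (\<gamma> (x, y))"
    unfolding drawn_arcs_def by auto
  have disj: "\<forall>e\<in>parcs H. \<forall>e'\<in>parcs H. {fst e, snd e} \<noteq> {fst e', snd e'} \<longrightarrow>
      path_image (\<gamma> e) \<inter> path_image (\<gamma> e') \<subseteq> p ` ({fst e, snd e} \<inter> {fst e', snd e'})"
    using drawing by (simp add: plane_drawing_def split_def)
  have "(u, v) \<in> parcs H" "(x, y) \<in> parcs H" "{u, v} \<noteq> {x, y}"
    using * assms by auto
  with disj have "path_image (\<gamma> (u, v)) \<inter> path_image (\<gamma> (x, y)) \<subseteq> p ` ({u, v} \<inter> {x, y})"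
    by (metis fst_conv snd_conv)
  with * have "z \<in> p ` ({u, v} \<inter> {x, y})"
    by blast
  then show "z \<in> p ` (Field R \<inter> Field R')"
    using * by (auto simp: Field_def)
qed

text \<open>The vertices \<open>x0\<close>, \<open>x1\<close>, \<open>x2\<close>, \<open>x3\<close>
  follow the outer cycle in this order, so the ends of the two connections alternate on it. Walks
  through the disjoint sets \<open>S\<close> and \<open>S'\<close> yield disjoint arcs, which the
  Jordan curve forces to cross.\<close>

lemma no_crossing_connections:
  assumes "pair_graph H"
    and cycle: "{(x0, x1), (x1, x2), (x2, x3), (x3, x0)} \<subseteq> parcs H" "distinct [x0, x1, x2, x3]"
    and face: "U \<in> faces H p \<gamma>" "\<not> bounded U"
      "frontier U = drawn_arcs \<gamma> {(x0, x1), (x1, x2), (x2, x3), (x3, x0)}"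
    and S: "S \<inter> S' = {}" "x0 \<in> S" "x2 \<in> S" "x1 \<in> S'" "x3 \<in> S'"
    and conn: "(x0, x2) \<in> (parcs H \<inter> S \<times> S)\<^sup>*" "(x1, x3) \<in> (parcs H \<inter> S' \<times> S')\<^sup>*"
  shows False
proof -
  interpret pair_graph H by fact
  let ?E = "{(x0, x1), (x1, x2), (x2, x3), (x3, x0)}"
  let ?R = "parcs H \<inter> S \<times> S" and ?R' = "parcs H \<inter> S' \<times> S'"
  have rev: "(x0, x3) \<in> parcs H" "(x3, x2) \<in> parcs H"
    using cycle arcs_symmetric by auto
  have X: "{x0, x1, x2, x3} \<subseteq> pverts H"
    using cycle by (auto dest: wellformed')
  have "inj_on p (pverts H)"
    using drawing unfolding plane_drawing_def by blast
  then have p_eq: "p y = p z \<longleftrightarrow> y = z" if "y \<in> {x0, x1, x2, x3}" "z \<in> {x0, x1, x2, x3}" for y z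
    using that X by (meson inj_on_eq_iff subsetD)
  \<comment> \<open>Cutting the outer cycle at \<open>x0\<close> and \<open>x2\<close> gives two
    arcs with common start and finish; \<open>c2\<close> runs against the direction of the cycle,
    along the edges from \<open>rev\<close>.\<close>
  define c1 where "c1 = \<gamma> (x0, x1) +++ \<gamma> (x1, x2)"
  define c2 where "c2 = \<gamma> (x0, x3) +++ \<gamma> (x3, x2)"
  have E: "(x0, x1) \<in> parcs H" "(x1, x2) \<in> parcs H" "(x0, x3) \<in> parcs H" "(x3, x2) \<in> parcs H"
    using cycle rev by auto
  note arcs = drawn_arc[OF E(1)] drawn_arc[OF E(2)] drawn_arc[OF E(3)] drawn_arc[OF E(4)]
  have im1: "path_image c1 = path_image (\<gamma> (x0, x1)) \<union> path_image (\<gamma> (x1, x2))"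
    and im2: "path_image c2 = path_image (\<gamma> (x0, x3)) \<union> path_image (\<gamma> (x3, x2))"
    unfolding c1_def c2_def using arcs by (auto simp: path_image_join)
  have C: "path_image c1 \<union> path_image c2 = drawn_arcs \<gamma> ?E"
    unfolding im1 im2 using arcs by (auto simp: drawn_arcs_def)
  have "path_image (\<gamma> (x0, x1)) \<inter> path_image (\<gamma> (x1, x2)) \<subseteq> {p x1}"
    using drawn_arcs_Int[of "{(x0, x1)}" "{(x1, x2)}"] E cycle(2)
    by (force simp: drawn_arcs_def Field_def doubleton_eq_iff)
  then have a1: "Path_Connected.arc c1"
    unfolding c1_def using arcs by (intro arc_join) auto
  have "path_image (\<gamma> (x0, x3)) \<inter> path_image (\<gamma> (x3, x2)) \<subseteq> {p x3}"
    using drawn_arcs_Int[of "{(x0, x3)}" "{(x3, x2)}"] E cycle(2)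
    by (force simp: drawn_arcs_def Field_def doubleton_eq_iff)
  then have a2: "Path_Connected.arc c2"
    unfolding c2_def using arcs by (intro arc_join) auto
  have ends: "pathstart c1 = p x0" "pathfinish c1 = p x2" "pathstart c2 = p x0" "pathfinish c2 = p x2"
    unfolding c1_def c2_def using arcs by auto
  have "drawn_arcs \<gamma> {(x0, x1), (x1, x2)} \<inter> drawn_arcs \<gamma> {(x0, x3), (x3, x2)} \<subseteq>
      p ` (Field {(x0, x1), (x1, x2)} \<inter> Field {(x0, x3), (x3, x2)})"
    using E cycle(2) by (intro drawn_arcs_Int) (auto simp: doubleton_eq_iff)
  moreover have "Field {(x0, x1), (x1, x2)} \<inter> Field {(x0, x3), (x3, x2)} = {x0, x2}"
    using cycle(2) by (auto simp: Field_def)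
  ultimately have "path_image c1 \<inter> path_image c2 \<subseteq> {p x0, p x2}"
    unfolding im1 im2 by (simp add: drawn_arcs_def)
  moreover have "{p x0, p x2} \<subseteq> path_image c1 \<inter> path_image c2"
    using ends by (metis IntI empty_subsetI insert_subset pathfinish_in_path_image pathstart_in_path_image)
  ultimately have c12: "path_image c1 \<inter> path_image c2 = {p x0, p x2}"
    by blast
  \<comment> \<open>Traversing \<open>c2\<close> backwards closes \<open>c1\<close> to a simple
    closed curve whose image is the drawn outer cycle, the frontier of \<open>U\<close>.\<close>
  define k where "k = c1 +++ reversepath c2"
  have k: "simple_path k" "pathfinish k = pathstart k" "path_image k = path_image c1 \<union> path_image c2"
    unfolding k_def using a1 a2 ends c12
    by (auto intro!: simple_path_join_loop arc_reversepath simp: path_image_join)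
  have inside: "drawn_arcs \<gamma> (parcs H) \<subseteq> path_image k \<union> inside (path_image k)"
  proof -
    have "path_image k \<subseteq> p ` pverts H \<union> drawn_arcs \<gamma> (parcs H)"
      unfolding k(3) C using cycle(1) by (auto simp: drawn_arcs_def)
    then show ?thesis
      using unbounded_face_bounded_by_Jordan_curve[of U "p ` pverts H \<union> drawn_arcs \<gamma> (parcs H)" k]
        face k C unfolding faces_def by auto
  qed
  \<comment> \<open>Each edge of the outer cycle joins \<open>S\<close> to \<open>S'\<close>, so it
    belongs to neither \<open>?R\<close> nor \<open>?R'\<close>. The drawing of \<open>?R\<close>
    therefore meets the cycle only in cycle vertices in \<open>S\<close>; likewise for
    \<open>?R'\<close> and \<open>S'\<close>.\<close>
  have RC: "drawn_arcs \<gamma> ?R \<inter> path_image k \<subseteq> {p x0, p x2}"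
  proof -
    have "drawn_arcs \<gamma> ?R \<inter> drawn_arcs \<gamma> ?E \<subseteq> p ` (Field ?R \<inter> Field ?E)"
      using cycle(1) S by (intro drawn_arcs_Int) (auto simp: doubleton_eq_iff)
    moreover have "Field ?R \<inter> Field ?E \<subseteq> {x0, x2}"
      using S by (auto simp: Field_def)
    ultimately show ?thesis
      unfolding k(3) C by blast
  qed
  have RC': "drawn_arcs \<gamma> ?R' \<inter> path_image k \<subseteq> {p x1, p x3}"
  proof -
    have "drawn_arcs \<gamma> ?R' \<inter> drawn_arcs \<gamma> ?E \<subseteq> p ` (Field ?R' \<inter> Field ?E)"
      using cycle(1) S by (intro drawn_arcs_Int) (auto simp: doubleton_eq_iff)
    moreover have "Field ?R' \<inter> Field ?E \<subseteq> {x1, x3}"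
      using S by (auto simp: Field_def)
    ultimately show ?thesis
      unfolding k(3) C by blast
  qed
  have "(x0, x2) \<in> ?R\<^sup>+" "(x1, x3) \<in> ?R'\<^sup>+"
    using conn cycle(2) by (auto dest: rtranclD)
  moreover have "p x0 \<noteq> p x2" "p x1 \<noteq> p x3"
    using p_eq cycle(2) by auto
  ultimately obtain g h where
    g: "Path_Connected.arc g" "pathstart g = p x0" "pathfinish g = p x2" "path_image g \<subseteq> drawn_arcs \<gamma> ?R" and
    h: "Path_Connected.arc h" "pathstart h = p x1" "pathfinish h = p x3" "path_image h \<subseteq> drawn_arcs \<gamma> ?R'"
    using arc_in_drawn_arcs[of ?R x0 x2] arc_in_drawn_arcs[of ?R' x1 x3] by (metis inf_le1)
  have "drawn_arcs \<gamma> ?R \<subseteq> drawn_arcs \<gamma> (parcs H)" "drawn_arcs \<gamma> ?R' \<subseteq> drawn_arcs \<gamma> (parcs H)"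
    by (auto simp: drawn_arcs_def)
  \<comment> \<open>All drawn edges lie on or inside \<open>k\<close>, and \<open>g\<close> and
    \<open>h\<close> touch \<open>k\<close> only at their ends.\<close>
  then have gi: "path_image g - {p x0, p x2} \<subseteq> inside (path_image c1 \<union> path_image c2)"
    and hi: "path_image h - {p x1, p x3} \<subseteq> inside (path_image c1 \<union> path_image c2)"
    using g(4) h(4) RC RC' inside unfolding k(3)[symmetric] by blast+
  have "p x1 \<in> path_image c1" "p x3 \<in> path_image c2"
    unfolding im1 im2 using arcs by (metis UnI1 pathfinish_in_path_image)+
  then have "p x1 \<in> path_image c1 - {p x0, p x2}" "p x3 \<in> path_image c2 - {p x0, p x2}"
    using p_eq cycle(2) by auto
  then have "path_image g \<inter> path_image h \<noteq> {}"
    using crossing_arcs_in_Jordan_curve[OF a1 ends(1,2) a2 ends(3,4) c12 g(1-3) gi h(1-3) hi] by blast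
  moreover have "drawn_arcs \<gamma> ?R \<inter> drawn_arcs \<gamma> ?R' \<subseteq> p ` (Field ?R \<inter> Field ?R')"
    using S(1) by (intro drawn_arcs_Int) (auto simp: doubleton_eq_iff)
  moreover have "Field ?R \<inter> Field ?R' = {}"
    using S(1) by (auto simp: Field_def)
  ultimately show False
    using g(4) h(4) by blast
qed

end

section \<open>From the web to its plane skeleton\<close>

text \<open>A connection through an attached clique enters and leaves it in vertices of one triangle,
  so it can be shortcut along an edge of that triangle.\<close>

lemma rtrancl_attach_cliques_imp_rtrancl:
  assumes "pair_graph H" "attachable H F"
    and conn: "(u, v) \<in> (parcs (attach_cliques H F) \<inter> S \<times> S)\<^sup>*"
    and uv: "u \<in> S" "u \<in> pverts H" "v \<in> pverts H"
  shows "(u, v) \<in> (parcs H \<inter> S \<times> S)\<^sup>*"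
proof -
  interpret pair_graph H by fact
  let ?R = "parcs H \<inter> S \<times> S"
  have sub: "T \<subseteq> pverts H" if "T \<in> triangles H" for T
    using that unfolding triangles_iff[OF assms(1)] by (auto dest: wellformed')
  have disj: "z \<notin> pverts H" if "T \<in> triangles H" "z \<in> F T" for T z
    using that assms(2) unfolding attachable_def by blast
  have uniq: "T = T'" if "T \<in> triangles H" "T' \<in> triangles H" "z \<in> F T" "z \<in> F T'" for T T' z
    using that assms(2) unfolding attachable_def by blast
  have edge: "(s, t) \<in> parcs H" if "T \<in> triangles H" "s \<in> T" "t \<in> T" "s \<noteq> t" for T s t
    using that arcs_symmetric unfolding triangles_iff[OF assms(1)] by auto
  \<comment> \<open>The induction must also cover walks that currently end inside a clique: for
    these it records a vertex \<open>t\<close> of the triangle that lies in \<open>S\<close> and is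
    already reached within \<open>H\<close>. On leaving the clique, \<open>t\<close> equals the exit
    vertex or is adjacent to it.\<close>
  have "(v \<in> pverts H \<longrightarrow> (u, v) \<in> ?R\<^sup>*) \<and>
      (\<forall>T\<in>triangles H. v \<in> F T \<longrightarrow> (\<exists>t\<in>T \<inter> S. (u, t) \<in> ?R\<^sup>*))"
    using conn
  proof induction
    case base
    then show ?case using uv disj by auto
  next
    case (step y z)
    have S: "y \<in> S" "z \<in> S" using step.hyps(2) by auto
    from step.hyps(2) consider
      (H) "(y, z) \<in> parcs H"
      | (F) T where "T \<in> triangles H" "y \<in> F T" "z \<in> F T"
      | (into) T where "T \<in> triangles H" "y \<in> T" "z \<in> F T"
      | (out) T where "T \<in> triangles H" "y \<in> F T" "z \<in> T"
      unfolding attach_cliques_def symcl_def by auto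
    then show ?case
    proof cases
      case H
      then have "y \<in> pverts H" "z \<in> pverts H" by (auto dest: wellformed')
      moreover have "(u, y) \<in> ?R\<^sup>*" using step.IH \<open>y \<in> pverts H\<close> by blast
      moreover have "(y, z) \<in> ?R" using H S by blast
      ultimately show ?thesis using disj by (meson rtrancl.rtrancl_into_rtrancl)
    next
      case F
      \<comment> \<open>Cliques of different triangles are disjoint, so the triangle and its
        recorded vertex stay the same.\<close>
      then show ?thesis using step.IH disj uniq by metis
    next
      case into
      then have "(u, y) \<in> ?R\<^sup>*" using step.IH sub by blast
      \<comment> \<open>The entry vertex \<open>y\<close> becomes the recorded vertex.\<close>
      then show ?thesis using into disj uniq S by blast
    next
      case out
      then obtain t where t: "t \<in> T" "t \<in> S" "(u, t) \<in> ?R\<^sup>*" using step.IH by blast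
      have "(u, z) \<in> ?R\<^sup>*"
      proof (cases "t = z")
        case False
        then have "(t, z) \<in> ?R" using edge out t S by blast
        then show ?thesis using t by (meson rtrancl.rtrancl_into_rtrancl)
      qed (use t in simp)
      then show ?thesis using out disj sub by blast
    qed
  qed
  then show ?thesis using uv by blast
qed

section \<open>Connections supplied by minor models\<close>

lemma pair_graph_connected_rtrancl:
  assumes "pair_graph B" "Digraph_Component.connected (with_proj B)" "u \<in> pverts B" "v \<in> pverts B"
  shows "(u, v) \<in> (parcs B)\<^sup>*"
proof -
  interpret pair_graph B by fact
  have "strongly_connected (with_proj B)"
    using symmetric_connected_imp_strongly_connected[OF sym_arcs assms(2)] .
  then have "u \<rightarrow>\<^sup>*\<^bsub>with_proj B\<^esub> v"
    using assms(3,4) by auto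
  then show ?thesis
    using reachable_rtranclI by fastforce
qed

text \<open>The walk passes from the branch set of \<open>i\<close> through that of \<open>k\<close>
  to that of \<open>j\<close>, moving inside each connected branch set between the joining edges.
  Confining it to \<open>S\<close> lets disjoint branch sets separate two such walks later.\<close>

lemma minor_model_rtrancl:
  assumes "minor_model K G B" "{i, k, j} \<subseteq> pverts K" "(i, k) \<in> parcs K" "(k, j) \<in> parcs K"
    and "u \<in> pverts (B i)" "v \<in> pverts (B j)"
  defines "S \<equiv> pverts (B i) \<union> pverts (B k) \<union> pverts (B j)"
  shows "(u, v) \<in> (parcs G \<inter> S \<times> S)\<^sup>*"
proof -
  let ?R = "parcs G \<inter> S \<times> S"
  have B: "(y, z) \<in> ?R\<^sup>*" if "l \<in> {i, k, j}" "y \<in> pverts (B l)" "z \<in> pverts (B l)" for l y z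
  proof -
    have l: "pair_graph (B l)" "subgraph (with_proj (B l)) (with_proj G)"
      "Digraph_Component.connected (with_proj (B l))"
      using assms(1,2) that(1) unfolding minor_model_def by auto
    interpret B: pair_graph "B l" by (rule l)
    have "pverts (B l) \<subseteq> S"
      using that(1) by (auto simp: S_def)
    moreover have "parcs (B l) \<subseteq> parcs G"
      using l(2) by (simp add: subgraph_def)
    ultimately have "parcs (B l) \<subseteq> ?R"
      by (auto dest: B.wellformed')
    then show ?thesis
      using pair_graph_connected_rtrancl[OF l(1,3) that(2,3)] rtrancl_mono by (meson subsetD)
  qed
  have joins: "\<exists>u\<in>pverts (B x). \<exists>v\<in>pverts (B y). (u, v) \<in> parcs G" if "(x, y) \<in> parcs K" for x y
    using assms(1) that unfolding minor_model_def by blast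
  obtain y y' z z' where yz: "y \<in> pverts (B i)" "y' \<in> pverts (B k)" "(y, y') \<in> parcs G"
    "z \<in> pverts (B k)" "z' \<in> pverts (B j)" "(z, z') \<in> parcs G"
    using joins[OF assms(3)] joins[OF assms(4)] by blast
  have "(u, y) \<in> ?R\<^sup>*" "(y, y') \<in> ?R" "(y', z) \<in> ?R\<^sup>*" "(z, z') \<in> ?R" "(z', v) \<in> ?R\<^sup>*"
    using B yz assms(5,6) by (auto simp: S_def)
  then show ?thesis
    by (meson rtrancl.rtrancl_into_rtrancl rtrancl_trans)
qed

text \<open>Each hub of \<open>K24\<close> is adjacent to the whole large side, so any pairing of
  the roots is possible: hub \<open>4\<close> serves \<open>x0\<close> and \<open>x2\<close>, hub
  \<open>5\<close> serves \<open>x1\<close> and \<open>x3\<close>.\<close>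

lemma K24_minor_connections:
  assumes "has_K24_minor X G" "{x0, x1, x2, x3} \<subseteq> X" "distinct [x0, x1, x2, x3]"
  obtains S S' where "S \<inter> S' = {}" "x0 \<in> S" "x2 \<in> S" "x1 \<in> S'" "x3 \<in> S'"
    "(x0, x2) \<in> (parcs G \<inter> S \<times> S)\<^sup>*" "(x1, x3) \<in> (parcs G \<inter> S' \<times> S')\<^sup>*"
proof -
  obtain B f where model: "minor_model K24 G B" and f: "inj_on f X" "f ` X \<subseteq> K24_large_side"
    "\<forall>v\<in>X. v \<in> pverts (B (f v))"
    using assms(1) unfolding has_K24_minor_def rooted_minor_def by blast
  have side: "f x \<in> K24_large_side" "x \<in> pverts (B (f x))" if "x \<in> {x0, x1, x2, x3}" for x
    using f assms(2) that by blast+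
  have verts: "{f x, 4, f y} \<subseteq> pverts K24" "{f x, 5, f y} \<subseteq> pverts K24"
    and edges: "(f x, 4) \<in> parcs K24" "(4, f x) \<in> parcs K24" "(f x, 5) \<in> parcs K24" "(5, f x) \<in> parcs K24"
    if "x \<in> {x0, x1, x2, x3}" "y \<in> {x0, x1, x2, x3}" for x y
    using side(1)[OF that(1)] side(1)[OF that(2)] by (force simp: K24_def symcl_def)+
  define S where "S = pverts (B (f x0)) \<union> pverts (B 4) \<union> pverts (B (f x2))"
  define S' where "S' = pverts (B (f x1)) \<union> pverts (B 5) \<union> pverts (B (f x3))"
  have disj: "pverts (B x) \<inter> pverts (B y) = {}" if "x \<in> pverts K24" "y \<in> pverts K24" "x \<noteq> y" for x y
    using model that unfolding minor_model_def by blast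
  \<comment> \<open>Injectivity of \<open>f\<close> keeps the four large-side vertices apart, so the
    index sets \<open>{f x0, 4, f x2}\<close> and \<open>{f x1, 5, f x3}\<close> are disjoint, and
    with them \<open>S\<close> and \<open>S'\<close>.\<close>
  have ne: "distinct (map f [x0, x1, x2, x3])"
    using inj_on_subset[OF f(1) assms(2)] assms(3) unfolding distinct_map by simp
  have hub: "f x \<notin> {4, 5}" if "x \<in> {x0, x1, x2, x3}" for x
    using side(1)[OF that] by (auto simp: K24_large_side_def)
  have "l \<in> pverts K24 \<and> l' \<in> pverts K24 \<and> l \<noteq> l'" if "l \<in> {f x0, 4, f x2}" "l' \<in> {f x1, 5, f x3}" for l l'
    using that verts[of x0 x2] verts[of x1 x3] ne hub[of x0] hub[of x1] hub[of x2] hub[of x3] by auto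
  then have "pverts (B l) \<inter> pverts (B l') = {}" if "l \<in> {f x0, 4, f x2}" "l' \<in> {f x1, 5, f x3}" for l l'
    using that disj by blast
  then have "S \<inter> S' = {}"
    unfolding S_def S'_def by blast
  moreover have "x0 \<in> S" "x2 \<in> S" "x1 \<in> S'" "x3 \<in> S'"
    using side(2) by (auto simp: S_def S'_def)
  moreover have "(x0, x2) \<in> (parcs G \<inter> S \<times> S)\<^sup>*"
    unfolding S_def using side(2)[of x0] side(2)[of x2] verts[of x0 x2] edges[of x0 x0] edges[of x2 x2]
    by (intro minor_model_rtrancl[OF model]) simp_all
  moreover have "(x1, x3) \<in> (parcs G \<inter> S' \<times> S')\<^sup>*"
    unfolding S'_def using side(2)[of x1] side(2)[of x3] verts[of x1 x3] edges[of x1 x1] edges[of x3 x3]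
    by (intro minor_model_rtrancl[OF model]) simp_all
  ultimately show ?thesis
    by (rule that)
qed

section \<open>The outer 4-cycle of the web and the contradiction\<close>

lemma cycle_of_length_4E:
  assumes "pair_graph H" "c \<in> cycles_of_length 4 H"
  obtains x0 x1 x2 x3 where "set c = {(x0, x1), (x1, x2), (x2, x3), (x3, x0)}"
    "distinct [x0, x1, x2, x3]" "set c \<subseteq> parcs H"
proof -
  interpret pair_graph H by fact
  have "cycle c" "length c = 4"
    using assms(2) by (simp_all add: cycles_of_length_def)
  from \<open>length c = 4\<close> obtain x x' y y' z z' w w' where c: "c = [(x, x'), (y, y'), (z, z'), (w, w')]"
    by (auto simp: numeral_eq_Suc length_Suc_conv)
  have "x' = y" "y' = z" "z' = w" "w' = x" "distinct [x, y, z, w]" "set c \<subseteq> parcs H"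
    using \<open>cycle c\<close> unfolding c cycle_def awalk_def by auto
  then show ?thesis
    using that[of x y z w] c by simp
qed

theorem theorem40:
  fixes G W :: "'a pair_pre_digraph" and X :: "'a set" and a b c d :: 'a
  assumes "pair_graph G"
    and "two_connected G"
    and "X = {a, b, c, d}"
    and "X \<subseteq> pverts G"
    and "card X = 4"
    and "web X W"
    and "spanning (with_proj G) (with_proj W)"
    and "\<not> has_W4_minor X G"
  shows "\<not> has_K24_minor X G"
proof
  assume K24: "has_K24_minor X G"
  obtain H F where H: "web_skeleton X H" "attachable H F" and W: "W = attach_cliques H F"
    using assms(6) unfolding web_def by blast
  from H(1) obtain p \<gamma> U cyc where pg: "pair_graph H" and drawing: "plane_drawing H p \<gamma>"
    and U: "U \<in> faces H p \<gamma>" "\<not> bounded U" "frontier U = drawn_arcs \<gamma> (set cyc)"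
    and cyc: "cyc \<in> cycles_of_length 4 H" "fst ` set cyc = X"
    unfolding web_skeleton_def by blast
  \<comment> \<open>The opposite pairs are read off the outer cycle, whose cyclic order on
    \<open>X\<close> may differ from \<open>a, b, c, d\<close>.\<close>
  from cycle_of_length_4E[OF pg cyc(1)] obtain x0 x1 x2 x3 where
    set: "set cyc = {(x0, x1), (x1, x2), (x2, x3), (x3, x0)}"
    and dist: "distinct [x0, x1, x2, x3]" and sub: "set cyc \<subseteq> parcs H" .
  have X: "{x0, x1, x2, x3} = X"
    using cyc(2) unfolding set by auto
  obtain S S' where S: "S \<inter> S' = {}" "x0 \<in> S" "x2 \<in> S" "x1 \<in> S'" "x3 \<in> S'"
    and conn: "(x0, x2) \<in> (parcs G \<inter> S \<times> S)\<^sup>*" "(x1, x3) \<in> (parcs G \<inter> S' \<times> S')\<^sup>*"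
    using K24_minor_connections[OF K24 _ dist] X by blast
  have "parcs G \<subseteq> parcs W"
    using assms(7) by (auto simp: spanning_def subgraph_def)
  then have "(x0, x2) \<in> (parcs W \<inter> S \<times> S)\<^sup>*" "(x1, x3) \<in> (parcs W \<inter> S' \<times> S')\<^sup>*"
    using conn rtrancl_mono[of "parcs G \<inter> S \<times> S" "parcs W \<inter> S \<times> S"]
      rtrancl_mono[of "parcs G \<inter> S' \<times> S'" "parcs W \<inter> S' \<times> S'"] by blast+
  moreover interpret H: pair_graph H by (rule pg)
  have "{x0, x1, x2, x3} \<subseteq> pverts H"
    using sub unfolding set by (auto dest: H.wellformed')
  \<comment> \<open>Both walks have their ends in \<open>H\<close>, so they can be pushed out of the
    cliques without leaving \<open>S\<close> and \<open>S'\<close>; this keeps them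
    disjoint.\<close>
  ultimately have "(x0, x2) \<in> (parcs H \<inter> S \<times> S)\<^sup>*" "(x1, x3) \<in> (parcs H \<inter> S' \<times> S')\<^sup>*"
    using S unfolding W by (auto intro: rtrancl_attach_cliques_imp_rtrancl[OF pg H(2)])
  then show False
    using no_crossing_connections[OF drawing pg _ dist U(1,2) _ S] U(3) sub unfolding set by blast
qed

end
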